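(* For every prime $p>2$, \[ \sum_{n=0}^{p-1}\frac{(-1)^n(154n+15)}{2^{15n}}\binom{6n}{3n}\binom{3n}{n}\binom{2n}{n}\equiv 0\pmod{p}. \]
   Context: For rational numbers $x,y$ and a prime $p$, $x\equiv y\pmod{p^r}$ means that $x-y$ is a rational number whose $p$-adic valuation is at least $r$. *)

theory Defs
  imports Complex_Main "HOL-Computational_Algebra.Primes"
begin

text \<open>The value at \<open>0\<close> is junk (it would be infinity); \<open>rat_cong\<close> treats that case separately.\<close>

definition padic_val :: "nat \<Rightarrow> rat \<Rightarrow> int" where
  "padic_val p x =
     (case quotient_of x of (a, b) \<Rightarrow>
        int (multiplicity (int p) a) - int (multiplicity (int p) b))"

text \<open>\<open>rat_cong p r x y\<close> is the congruence of \<open>x\<close> and \<open>y\<close> modulo \<open>p ^ r\<close>, for prime \<open>p\<close>.\<close>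

definition rat_cong :: "nat \<Rightarrow> nat \<Rightarrow> rat \<Rightarrow> rat \<Rightarrow> bool" where
  "rat_cong p r x y \<longleftrightarrow> x = y \<or> padic_val p (x - y) \<ge> int r"

end

theory Submission
  imports Defs
begin

text \<open>
  Put \<open>t(n,j) = (-1)^n (1/2)\<^sub>n\<^sub>+\<^sub>2\<^sub>j (1/2)\<^sub>n^2 / (8^n 4^j n! (n+j)!^2)\<close>,
  written below with \<open>(1/2)\<^sub>m = (2m)! / (4^m m!)\<close>. Then
  \<open>F(n,j) = (6n+4j+1) t(n,j)\<close> and \<open>G(n,j) = 4n t(n,j)\<close> form a WZ pair, i.e. they are the two
  components of a closed discrete 1-form, and the staircase steps along the diagonal are
  \<open>F(n,n) + G(n+1,n) = (154n+15) t(n,n) / 16\<close>, where \<open>t(n,n)\<close> is the hypergeometric term of the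
  theorem. The sum is therefore 16 times the integral of this form along any path from
  \<open>(0,0)\<close> to \<open>(p,p)\<close>. Take the path through \<open>(0,J)\<close> and \<open>(p,J)\<close>, where \<open>J = (p-1)/2\<close>: its first leg
  contributes nothing since \<open>G(0,j) = 0\<close>, and on the other two legs every single summand is
  divisible by \<open>p\<close>.
\<close>

section \<open>The WZ pair: term ratios, closedness and the diagonal step\<close>

definition wz_term :: "nat \<Rightarrow> nat \<Rightarrow> rat" where
  "wz_term n j = (- 1) ^ n * fact (2 * n + 4 * j) * fact (2 * n) ^ 2 /
     (2 ^ (9 * n + 6 * j) * fact (n + 2 * j) * fact n ^ 3 * fact (n + j) ^ 2)"

definition wz_F :: "nat \<Rightarrow> nat \<Rightarrow> rat" where
  "wz_F n j = (6 * of_nat n + 4 * of_nat j + 1) * wz_term n j"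

definition wz_G :: "nat \<Rightarrow> nat \<Rightarrow> rat" where
  "wz_G n j = 4 * of_nat n * wz_term n j"

lemma wz_term_Suc_left:
  "wz_term (Suc n) j = - (2 * of_nat n + 4 * of_nat j + 1) * (2 * of_nat n + 1) ^ 2 /
     (64 * (of_nat n + of_nat j + 1) ^ 2 * (of_nat n + 1)) * wz_term n j"
proof -
  define x y :: rat where "x = of_nat n" and "y = of_nat j"
  have nz: "x + 1 \<noteq> 0" "x + y + 1 \<noteq> 0" "x + 2 * y + 1 \<noteq> 0"
    unfolding x_def y_def by (simp_all add: add_nonneg_eq_0_iff flip: of_nat_Suc of_nat_add)
  have f1: "(fact (2 * Suc n + 4 * j) :: rat)
      = 2 * (x + 2 * y + 1) * (2 * x + 4 * y + 1) * fact (2 * n + 4 * j)"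
    by (simp add: x_def y_def algebra_simps)
  have f2: "(fact (2 * Suc n) :: rat) = 2 * (x + 1) * (2 * x + 1) * fact (2 * n)"
    by (simp add: x_def algebra_simps)
  have f3: "(fact (Suc n + 2 * j) :: rat) = (x + 2 * y + 1) * fact (n + 2 * j)"
    by (simp add: x_def y_def algebra_simps)
  have f4: "(fact (Suc n) :: rat) = (x + 1) * fact n"
    by (simp add: x_def algebra_simps)
  have f5: "(fact (Suc n + j) :: rat) = (x + y + 1) * fact (n + j)"
    by (simp add: x_def y_def algebra_simps)
  have f6: "(2 :: rat) ^ (9 * Suc n + 6 * j) = 512 * 2 ^ (9 * n + 6 * j)"
    by (simp add: power_add)
  \<comment> \<open>Generalising the factorials and powers to arbitrary rationals, nonzero in the
    denominator, leaves an identity of rational functions.\<close>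
  have "- s * (2 * (x + 2 * y + 1) * (2 * x + 4 * y + 1) * a) * (2 * (x + 1) * (2 * x + 1) * b) ^ 2 /
      (512 * c * ((x + 2 * y + 1) * d) * ((x + 1) * e) ^ 3 * ((x + y + 1) * f) ^ 2)
    = - (2 * x + 4 * y + 1) * (2 * x + 1) ^ 2 / (64 * (x + y + 1) ^ 2 * (x + 1)) *
      (s * a * b ^ 2 / (c * d * e ^ 3 * f ^ 2))"
    if "c \<noteq> 0" "d \<noteq> 0" "e \<noteq> 0" "f \<noteq> 0" for s a b c d e f :: rat
    using nz that by (simp add: divide_simps) algebra
  from this[of "2 ^ (9 * n + 6 * j)" "fact (n + 2 * j)" "fact n" "fact (n + j)" "(- 1) ^ n"
      "fact (2 * n + 4 * j)" "fact (2 * n)"]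
  show ?thesis
    unfolding wz_term_def f1 f2 f3 f4 f5 f6 x_def[symmetric] y_def[symmetric] by simp
qed

lemma wz_term_Suc_right:
  "wz_term n (Suc j) = (2 * of_nat n + 4 * of_nat j + 1) * (2 * of_nat n + 4 * of_nat j + 3) /
     (16 * (of_nat n + of_nat j + 1) ^ 2) * wz_term n j"
proof -
  define x y :: rat where "x = of_nat n" and "y = of_nat j"
  have nz: "x + y + 1 \<noteq> 0" "x + 2 * y + 1 \<noteq> 0" "x + 2 * y + 2 \<noteq> 0"
    unfolding x_def y_def by (simp_all add: add_nonneg_eq_0_iff flip: of_nat_Suc of_nat_add)
  \<comment> \<open>The two even factors are written as 4(x+2y+1)(x+2y+2), which cancels against the
    new factors of \<open>fact (n + 2 * Suc j)\<close> in \<open>f2\<close>.\<close>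
  have f1: "(fact (2 * n + 4 * Suc j) :: rat)
      = 4 * (x + 2 * y + 2) * (2 * x + 4 * y + 3) * (x + 2 * y + 1) * (2 * x + 4 * y + 1)
        * fact (2 * n + 4 * j)"
  proof -
    have "2 * n + 4 * Suc j = Suc (Suc (Suc (Suc (2 * n + 4 * j))))" by simp
    then have "(fact (2 * n + 4 * Suc j) :: rat) = (2 * x + 4 * y + 4) * ((2 * x + 4 * y + 3) *
        ((2 * x + 4 * y + 2) * ((2 * x + 4 * y + 1) * fact (2 * n + 4 * j))))"
      by (simp only: fact_Suc) (simp add: x_def y_def algebra_simps)
    then show ?thesis by (simp add: algebra_simps)
  qed
  have f2: "(fact (n + 2 * Suc j) :: rat) = (x + 2 * y + 2) * (x + 2 * y + 1) * fact (n + 2 * j)"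
    by (simp add: x_def y_def algebra_simps)
  have f3: "(fact (n + Suc j) :: rat) = (x + y + 1) * fact (n + j)"
    by (simp add: x_def y_def algebra_simps)
  have f4: "(2 :: rat) ^ (9 * n + 6 * Suc j) = 64 * 2 ^ (9 * n + 6 * j)"
    by (simp add: power_add)
  show ?thesis
    unfolding wz_term_def f1 f2 f3 f4
    unfolding x_def[symmetric] y_def[symmetric] power_mult_distrib
    using nz by (simp add: divide_simps)
qed

text \<open>Both neighbours of \<open>wz_term n j\<close> are rational multiples of it, so the claim
  reduces to a rational function identity in n and j.\<close>

lemma wz_pair: "wz_F n (Suc j) - wz_F n j = wz_G (Suc n) j - wz_G n j"
proof -
  define x y t :: rat where "x = of_nat n" and "y = of_nat j" and "t = wz_term n j"
  have nz: "x + 1 \<noteq> 0" "x + y + 1 \<noteq> 0"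
    unfolding x_def y_def by (simp_all add: add_nonneg_eq_0_iff flip: of_nat_Suc of_nat_add)
  have "(6 * x + 4 * (y + 1) + 1) *
          ((2 * x + 4 * y + 1) * (2 * x + 4 * y + 3) / (16 * (x + y + 1) ^ 2) * t)
        - (6 * x + 4 * y + 1) * t
      = 4 * (x + 1) * (- (2 * x + 4 * y + 1) * (2 * x + 1) ^ 2 /
          (64 * (x + y + 1) ^ 2 * (x + 1)) * t) - 4 * x * t"
    using nz by (simp add: divide_simps) algebra
  then show ?thesis
    unfolding wz_F_def wz_G_def wz_term_Suc_left wz_term_Suc_right
    by (simp add: x_def y_def t_def add.commute)
qed

text \<open>At j = n the factor (n+j)!^2 cancels (2n)!^2, leaving (6n)! / ((3n)! n!^3) up to sign
  and a power of 2; the product of the three binomials collapses to the same quotient.\<close>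

lemma wz_term_diagonal:
  "wz_term n n = (- 1) ^ n / 2 ^ (15 * n) * of_nat ((6 * n) choose (3 * n))
     * of_nat ((3 * n) choose n) * of_nat ((2 * n) choose n)"
proof -
  have "(of_nat ((6 * n) choose (3 * n)) :: rat) = fact (6 * n) / (fact (3 * n) * fact (3 * n))"
    "(of_nat ((3 * n) choose n) :: rat) = fact (3 * n) / (fact n * fact (2 * n))"
    "(of_nat ((2 * n) choose n) :: rat) = fact (2 * n) / (fact n * fact n)"
    by (subst binomial_fact; simp)+
  moreover have "wz_term n n = (- 1) ^ n * fact (6 * n) * fact (2 * n) ^ 2 /
     (2 ^ (15 * n) * fact (3 * n) * fact n ^ 3 * fact (2 * n) ^ 2)"
    unfolding wz_term_def by (simp flip: mult_2)
  ultimately show ?thesis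
    by (simp add: power2_eq_square power3_eq_cube)
qed

text \<open>On the diagonal n+j+1 becomes 2n+1 and cancels, so G contributes only -(6n+1)/16; adding
  10n+1 from F gives the linear factor.\<close>

lemma wz_staircase_step: "wz_F n n + wz_G (Suc n) n = (154 * of_nat n + 15) / 16 * wz_term n n"
proof -
  define x t :: rat where "x = of_nat n" and "t = wz_term n n"
  have nz: "x + 1 \<noteq> 0" "2 * x + 1 \<noteq> 0"
    unfolding x_def by (simp_all add: add_nonneg_eq_0_iff flip: of_nat_Suc of_nat_add)
  have "(6 * x + 4 * x + 1) * t + 4 * (x + 1) * (- (2 * x + 4 * x + 1) * (2 * x + 1) ^ 2 /
          (64 * (2 * x + 1) ^ 2 * (x + 1)) * t) = (154 * x + 15) / 16 * t"
    using nz by (simp add: divide_simps) algebra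
  then show ?thesis
    unfolding wz_F_def wz_G_def wz_term_Suc_left
    by (simp add: x_def t_def add.commute flip: mult_2)
qed

section \<open>Path independence for closed discrete 1-forms\<close>

lemma WZ_sum_shift:
  fixes F G :: "nat \<Rightarrow> nat \<Rightarrow> 'a :: ab_group_add"
  assumes "\<And>n j. F n (Suc j) - F n j = G (Suc n) j - G n j"
  shows "(\<Sum>n<N. F n J) = (\<Sum>n<N. F n 0) + (\<Sum>j<J. G N j) - (\<Sum>j<J. G 0 j)"
proof (induction J)
  case (Suc J)
  \<comment> \<open>Raising the row by one changes its sum only by the two boundary terms at n = 0
    and n = N.\<close>
  have "(\<Sum>n<N. F n (Suc J)) - (\<Sum>n<N. F n J) = (\<Sum>n<N. G (Suc n) J - G n J)"
    by (simp add: assms flip: sum_subtractf)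
  also have "\<dots> = G N J - G 0 J"
    by (rule sum_lessThan_telescope)
  finally show ?case
    using Suc by (simp add: algebra_simps)
qed simp

text \<open>The staircase is deformed to the bottom row followed by the right column. In the
  induction the column n = N moves to n = N+1, and the change telescopes in j.\<close>

lemma WZ_sum_staircase:
  fixes F G :: "nat \<Rightarrow> nat \<Rightarrow> 'a :: ab_group_add"
  assumes wz: "\<And>n j. F n (Suc j) - F n j = G (Suc n) j - G n j"
  shows "(\<Sum>n<N. F n n + G (Suc n) n) = (\<Sum>n<N. F n 0) + (\<Sum>j<N. G N j)"
proof (induction N)
  case (Suc N)
  have "(\<Sum>j<N. G (Suc N) j) - (\<Sum>j<N. G N j) = (\<Sum>j<N. F N (Suc j) - F N j)"
    by (simp add: wz flip: sum_subtractf)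
  also have "\<dots> = F N N - F N 0"
    by (rule sum_lessThan_telescope)
  finally show ?case
    using Suc by (simp add: algebra_simps)
qed simp

text \<open>The two previous lemmas share the bottom row j = 0; eliminating its sum leaves of the
  column n = N only the part from height J upwards.\<close>

lemma WZ_sum_path:
  fixes F G :: "nat \<Rightarrow> nat \<Rightarrow> 'a :: ab_group_add"
  assumes wz: "\<And>n j. F n (Suc j) - F n j = G (Suc n) j - G n j" and "J \<le> N"
  shows "(\<Sum>n<N. F n n + G (Suc n) n)
    = (\<Sum>j<J. G 0 j) + (\<Sum>n<N. F n J) + (\<Sum>j=J..<N. G N j)"
proof -
  have "(\<Sum>j<N. G N j) = (\<Sum>j<J. G N j) + (\<Sum>j=J..<N. G N j)"
    using \<open>J \<le> N\<close> by (simp add: lessThan_atLeast0 sum.atLeastLessThan_concat)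
  then show ?thesis
    using WZ_sum_staircase[of F G N, OF wz] WZ_sum_shift[of F G J N, OF wz] by (simp add: algebra_simps)
qed

section \<open>Powers of p in factorials\<close>

lemma power_div_dvd_fact:
  fixes p m :: nat
  shows "p ^ (m div p) dvd fact m"
proof (cases "p = 0")
  case False
  have "p ^ k dvd fact (p * k)" for k
  proof (induction k)
    case (Suc k)
    \<comment> \<open>The last factor of (p(k+1))! supplies the additional p.\<close>
    have "Suc (p * k + (p - 1)) = p * Suc k"
      using False by simp
    then have eq: "fact (p * Suc k) = p * Suc k * fact (p * k + (p - 1))"
      by (metis fact_Suc of_nat_id)
    have "p ^ k dvd fact (p * k + (p - 1))"
      using Suc.IH by (rule dvd_trans) (simp add: fact_dvd)
    then show ?case
      unfolding eq by (simp add: mult_dvd_mono)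
  qed simp
  then show ?thesis
    by (rule dvd_trans) (simp add: fact_dvd)
qed simp

text \<open>Below p^2 each multiple of p contributes exactly one factor p, so the valuation of m! is
  the number of such multiples up to m.\<close>

lemma prime_power_not_dvd_fact:
  fixes p m :: nat
  assumes "prime p" and "m < p ^ 2"
  shows "\<not> p ^ Suc (m div p) dvd fact m"
  using assms(2)
proof (induction m)
  case 0
  then show ?case using \<open>prime p\<close> by (simp add: prime_nat_iff)
next
  case (Suc m)
  have p0: "p > 0" using \<open>prime p\<close> by (simp add: prime_gt_0_nat)
  have IH: "\<not> p ^ Suc (m div p) dvd fact m" using Suc by simp
  show ?case
  proof (cases "p dvd Suc m")
    case False
    then have "coprime (p ^ Suc (m div p)) (Suc m)"
      using \<open>prime p\<close> by (simp add: prime_imp_coprime)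
    moreover have "Suc m div p = m div p"
      using False by (simp add: div_Suc mod_eq_0_iff_dvd)
    ultimately show ?thesis
      using IH by (simp add: fact_Suc coprime_dvd_mult_right_iff del: power_Suc mult_Suc)
  next
    case True
    then obtain c where c: "Suc m = p * c" by blast
    have "0 < c" "c < p" using c Suc.prems by (auto simp: power2_eq_square intro: Nat.gr0I)
    then have cop: "coprime (p ^ Suc (m div p)) c"
      using \<open>prime p\<close> by (simp add: prime_imp_coprime nat_dvd_not_less)
    have "Suc m div p = Suc (m div p)"
      using True by (simp add: div_Suc mod_eq_0_iff_dvd)
    moreover have "fact (Suc m) = p * (c * fact m)"
      using fact_Suc[of m, where 'a = nat] unfolding c by (simp only: of_nat_id mult.assoc)
    ultimately show ?thesis
      using IH cop p0 by (simp add: coprime_dvd_mult_right_iff)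
  qed
qed

lemma fact_eq_prime_power_mult:
  fixes p m :: nat
  assumes "prime p" and "m < p ^ 2"
  obtains c where "fact m = p ^ (m div p) * c" and "\<not> p dvd c"
proof -
  obtain c where c: "fact m = p ^ (m div p) * c"
    using power_div_dvd_fact by (rule dvdE)
  moreover have "\<not> p dvd c"
    using prime_power_not_dvd_fact[OF assms] unfolding c power_Suc2 by (meson mult_dvd_mono dvd_refl)
  ultimately show thesis by (rule that)
qed

section \<open>The ideal generated by p in the integers localised at p\<close>

definition cong_zero :: "nat \<Rightarrow> rat \<Rightarrow> bool" where
  "cong_zero p x \<longleftrightarrow> (\<exists>a b. x = of_int (int p * a) / of_int b \<and> \<not> int p dvd b)"

lemma cong_zero_0 [simp]: "prime p \<Longrightarrow> cong_zero p 0"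
  unfolding cong_zero_def by (intro exI[of _ 0] exI[of _ 1]) auto

lemma cong_zero_add:
  assumes "prime p" "cong_zero p x" "cong_zero p y"
  shows "cong_zero p (x + y)"
proof -
  obtain a b c d where x: "x = of_int (int p * a) / of_int b" "\<not> int p dvd b"
    and y: "y = of_int (int p * c) / of_int d" "\<not> int p dvd d"
    using assms(2,3) unfolding cong_zero_def by blast
  have "b \<noteq> 0" "d \<noteq> 0" using x y by auto
  then have "x + y = of_int (int p * (a * d + c * b)) / of_int (b * d)"
    unfolding x y by (simp add: field_simps)
  moreover have "\<not> int p dvd b * d"
    using x y \<open>prime p\<close> by (simp add: prime_dvd_mult_iff)
  ultimately show ?thesis unfolding cong_zero_def by blast
qed

lemma cong_zero_mult_of_int:
  assumes "cong_zero p x"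
  shows "cong_zero p (of_int c * x)"
proof -
  obtain a b where "x = of_int (int p * a) / of_int b" "\<not> int p dvd b"
    using assms unfolding cong_zero_def by blast
  then show ?thesis
    unfolding cong_zero_def by (intro exI[of _ "a * c"] exI[of _ b]) simp
qed

lemma cong_zero_sum:
  assumes "prime p" "\<And>i. i \<in> A \<Longrightarrow> cong_zero p (f i)"
  shows "cong_zero p (sum f A)"
  using assms by (induction A rule: infinite_finite_induct) (auto intro: cong_zero_add)

text \<open>\<open>cong_zero\<close> allows unreduced fractions, which makes it easy to add, while
  \<open>padic_val\<close> reads the reduced one. Cross-multiplying moves the factor p to the
  reduced numerator. Zero is separate, since \<open>padic_val p 0\<close> is 0.\<close>

lemma cong_zero_imp_rat_cong:
  assumes "prime p" "cong_zero p x"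
  shows "rat_cong p 1 x 0"
proof (cases "x = 0")
  case False
  obtain a b where x: "x = of_int (int p * a) / of_int b" "\<not> int p dvd b"
    using assms unfolding cong_zero_def by blast
  obtain c d where cd: "quotient_of x = (c, d)" by fastforce
  have d: "d > 0" "coprime c d" and xcd: "x = of_int c / of_int d"
    using quotient_of_denom_pos[OF cd] quotient_of_coprime[OF cd] quotient_of_div[OF cd] by auto
  have "b \<noteq> 0" using x by auto
  then have "(of_int (c * b) :: rat) = of_int (int p * a * d)"
    using x(1) xcd d by (simp add: field_simps)
  then have "c * b = int p * a * d" by (simp only: of_int_eq_iff)
  then have "int p dvd c * b" by simp
  then have pc: "int p dvd c"
    using x(2) \<open>prime p\<close> by (simp add: prime_dvd_mult_iff)
  then have "\<not> int p dvd d"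
    using d(2) \<open>prime p\<close> by (meson coprime_common_divisor not_prime_unit prime_nat_int_transfer)
  then have "multiplicity (int p) d = 0" by (rule not_dvd_imp_multiplicity_0)
  moreover have "c \<noteq> 0" using False xcd by auto
  then have "multiplicity (int p) c \<ge> 1"
    using pc \<open>prime p\<close> by (intro multiplicity_geI) (auto simp: prime_gt_1_nat)
  ultimately show ?thesis
    unfolding rat_cong_def padic_val_def by (simp add: cd)
qed (simp add: rat_cong_def)

section \<open>Divisibility of the summands on the deformed path\<close>

lemma cong_zero_wz_term:
  assumes p: "prime p" "p > 2" and lt: "n + 2 * j < p ^ 2"
    and val: "(n + 2 * j) div p + 3 * (n div p) + 2 * ((n + j) div p)
      < e + (2 * n + 4 * j) div p + 2 * (2 * n div p)"
  shows "cong_zero p (of_nat p ^ e * wz_term n j)"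
proof -
  \<comment> \<open>For the numerator, whose argument \<open>2 * n + 4 * j\<close> may exceed p^2, a
    lower bound on the valuation suffices. The denominator needs exact valuations; \<open>lt\<close>
    provides them, \<open>n + 2 * j\<close> being its largest factorial argument.\<close>
  obtain A where A: "fact (2 * n + 4 * j) = p ^ ((2 * n + 4 * j) div p) * A"
    using power_div_dvd_fact by (rule dvdE)
  obtain B where B: "fact (2 * n) = p ^ (2 * n div p) * B"
    using power_div_dvd_fact by (rule dvdE)
  obtain C where C: "fact (n + 2 * j) = p ^ ((n + 2 * j) div p) * C" "\<not> p dvd C"
    using fact_eq_prime_power_mult[OF p(1) lt] by blast
  obtain D where D: "fact n = p ^ (n div p) * D" "\<not> p dvd D"
    using fact_eq_prime_power_mult[OF p(1), of n] lt by auto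
  obtain E where E: "fact (n + j) = p ^ ((n + j) div p) * E" "\<not> p dvd E"
    using fact_eq_prime_power_mult[OF p(1), of "n + j"] lt by auto
  \<comment> \<open>The denominator contains exactly p^u and the numerator at least p^w; s is the
    surplus beyond the single p required.\<close>
  define u where "u = (n + 2 * j) div p + 3 * (n div p) + 2 * ((n + j) div p)"
  define w where "w = e + (2 * n + 4 * j) div p + 2 * (2 * n div p)"
  define s where "s = w - Suc u"
  have w: "w = Suc (s + u)" using val by (simp add: s_def u_def w_def)
  define b where "b = 2 ^ (9 * n + 6 * j) * C * D ^ 3 * E ^ 2"
  define a where "a = p ^ s * A * B ^ 2"
  have p0: "(of_nat p :: rat) \<noteq> 0" using p by simp
  have pow: "p ^ (2 * k) = (p ^ k) ^ 2" "p ^ (3 * k) = (p ^ k) ^ 3" for k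
    by (simp_all add: mult.commute flip: power_mult)
  have num: "(of_nat p ^ e * ((- 1) ^ n * fact (2 * n + 4 * j) * fact (2 * n) ^ 2) :: rat)
      = of_nat p ^ u * (of_nat p * ((- 1) ^ n * of_nat a))"
  proof -
    have "p ^ e * (fact (2 * n + 4 * j) * fact (2 * n) ^ 2) = p ^ w * (A * B ^ 2)"
      unfolding A B w_def power_add pow by (simp add: power_mult_distrib)
    also have "\<dots> = p ^ u * (p * a)"
      unfolding w a_def by (simp add: power_add mult_ac)
    finally have "(of_nat (p ^ e * (fact (2 * n + 4 * j) * fact (2 * n) ^ 2)) :: rat)
      = of_nat (p ^ u * (p * a))" by (rule arg_cong)
    then show ?thesis by (simp add: mult_ac)
  qed
  have den: "(2 ^ (9 * n + 6 * j) * fact (n + 2 * j) * fact n ^ 3 * fact (n + j) ^ 2 :: rat)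
      = of_nat p ^ u * of_nat b"
  proof -
    have "2 ^ (9 * n + 6 * j) * fact (n + 2 * j) * fact n ^ 3 * fact (n + j) ^ 2 = p ^ u * b"
      unfolding C(1) D(1) E(1) u_def b_def power_add[of p] pow
      by (simp add: power_mult_distrib)
    then have "(of_nat (2 ^ (9 * n + 6 * j) * fact (n + 2 * j) * fact n ^ 3 * fact (n + j) ^ 2) :: rat)
      = of_nat (p ^ u * b)" by (rule arg_cong)
    then show ?thesis by simp
  qed
  have "of_nat p ^ e * wz_term n j = of_int (int p * ((- 1) ^ n * int a)) / of_int (int b)"
    unfolding wz_term_def den times_divide_eq_right num using p0 by simp
  moreover have "\<not> p dvd 2 ^ (9 * n + 6 * j)"
    using p by (meson dvd_imp_le leD pos2 prime_dvd_power)
  then have "\<not> p dvd b"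
    using C(2) D(2) E(2) p unfolding b_def
    by (auto simp: prime_dvd_mult_iff prime_dvd_power_iff)
  then have "\<not> int p dvd int b" by simp
  ultimately show ?thesis
    unfolding cong_zero_def by blast
qed

lemma cong_zero_wz_F_middle:
  assumes p: "prime p" "p = 2 * J + 1" "J > 0" and n: "n < p"
  shows "cong_zero p (wz_F n J)"
proof -
  have "n + 2 * J < 2 * p" using p n by simp
  also have "2 * p \<le> p ^ 2" using p by (simp add: power2_eq_square)
  finally have lt: "n + 2 * J < p ^ 2" .
  have n0: "n div p = 0" using n by simp
  \<comment> \<open>Since 2J = p-1, the counts of p (denominator against numerator) are 0 against at
    least 1, then 1 against at least 2, and finally at most 3 against at least 4, where (2n)!^2
    supplies two.\<close>
  consider "n = 0" | "0 < n" "n \<le> J" | "J < n" by linarith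
  then have "(n + 2 * J) div p + 3 * (n div p) + 2 * ((n + J) div p)
      < 0 + (2 * n + 4 * J) div p + 2 * (2 * n div p)"
  proof cases
    case 1
    moreover have "4 * J div p \<ge> 1" using p by (simp add: div_greater_zero_iff Suc_le_eq)
    ultimately show ?thesis using p by simp
  next
    case 2
    have "(n + 2 * J) div p < 2" "(n + J) div p < 1"
      using p 2 by (simp_all add: div_less_iff_less_mult)
    moreover have "(2 * n + 4 * J) div p \<ge> 2" using p 2 by (simp add: less_eq_div_iff_mult_less_eq)
    ultimately show ?thesis using n0 by linarith
  next
    case 3
    have "(n + 2 * J) div p < 2" "(n + J) div p < 2"
      using p 3 n by (simp_all add: div_less_iff_less_mult)
    moreover have "(2 * n + 4 * J) div p \<ge> 2" "2 * n div p \<ge> 1"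
      using p 3 by (simp_all add: less_eq_div_iff_mult_less_eq)
    ultimately show ?thesis using n0 by linarith
  qed
  then have "cong_zero p (of_nat p ^ 0 * wz_term n J)"
    using p lt by (intro cong_zero_wz_term) auto
  then have "cong_zero p (of_int (6 * int n + 4 * int J + 1) * wz_term n J)"
    by (intro cong_zero_mult_of_int) simp
  then show ?thesis by (simp add: wz_F_def)
qed

lemma cong_zero_wz_G_end:
  assumes p: "prime p" "p = 2 * J + 1" "J > 0" and j: "J \<le> j" "j < p"
  shows "cong_zero p (wz_G p j)"
proof -
  have "2 < p" using p(2,3) by linarith
  have "p + 2 * j < 3 * p" using j by simp
  also have "3 * p \<le> p ^ 2" using \<open>2 < p\<close> by (simp add: power2_eq_square)
  finally have lt: "p + 2 * j < p ^ 2" .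
  \<comment> \<open>The denominator holds at most 2+3+2 = 7 factors p, the numerator at least 3+4 =
    7; the factor n = p of \<open>wz_G\<close> supplies the eighth, hence e = 1.\<close>
  have "p > 0" "3 * p \<le> 2 * p + 4 * j" using p(2,3) j by linarith+
  then have "(2 * p + 4 * j) div p \<ge> 3" "2 * p div p = 2" "p div p = 1"
    by (simp_all add: less_eq_div_iff_mult_less_eq)
  moreover have "(p + 2 * j) div p < 3" "(p + j) div p < 2"
    using \<open>p > 0\<close> j by (simp_all add: div_less_iff_less_mult)
  ultimately have "(p + 2 * j) div p + 3 * (p div p) + 2 * ((p + j) div p)
      < 1 + (2 * p + 4 * j) div p + 2 * (2 * p div p)"
    by (simp only:)
  then have "cong_zero p (of_nat p ^ 1 * wz_term p j)"
    by (rule cong_zero_wz_term[OF p(1) \<open>2 < p\<close> lt])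
  then have "cong_zero p (of_int 4 * (of_nat p ^ 1 * wz_term p j))"
    by (rule cong_zero_mult_of_int)
  then show ?thesis by (simp add: wz_G_def mult.assoc)
qed

theorem theorem6:
  fixes p :: nat
  assumes "prime p" and "p > 2"
  shows "rat_cong p 1
    (\<Sum>n = 0..p - 1.
       ((- 1) ^ n * (154 * rat_of_nat n + 15) / 2 ^ (15 * n))
         * rat_of_nat ((6 * n) choose (3 * n))
         * rat_of_nat ((3 * n) choose n)
         * rat_of_nat ((2 * n) choose n))
    0"
proof -
  have "odd p" using assms by (simp add: prime_odd_nat)
  then obtain J where J: "p = 2 * J + 1" by (rule oddE)
  then have "J > 0" "J \<le> p" using assms by auto
  have G0: "wz_G 0 j = 0" for j by (simp add: wz_G_def)
  have "{0..p - 1} = {..<p}" using assms by auto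
  \<comment> \<open>The factor 16 clears the denominator in \<open>wz_staircase_step\<close>; it is
    an integer, so it preserves divisibility by p.\<close>
  then have "(\<Sum>n = 0..p - 1.
       ((- 1) ^ n * (154 * rat_of_nat n + 15) / 2 ^ (15 * n))
         * rat_of_nat ((6 * n) choose (3 * n))
         * rat_of_nat ((3 * n) choose n)
         * rat_of_nat ((2 * n) choose n))
      = of_int 16 * (\<Sum>n<p. wz_F n n + wz_G (Suc n) n)"
    by (simp add: wz_staircase_step wz_term_diagonal sum_distrib_left mult_ac)
  also have "\<dots> = of_int 16 * ((\<Sum>n<p. wz_F n J) + (\<Sum>j=J..<p. wz_G p j))"
    by (subst WZ_sum_path[of wz_F wz_G, OF wz_pair \<open>J \<le> p\<close>]) (simp add: G0)
  finally have eq: "(\<Sum>n = 0..p - 1.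
       ((- 1) ^ n * (154 * rat_of_nat n + 15) / 2 ^ (15 * n))
         * rat_of_nat ((6 * n) choose (3 * n))
         * rat_of_nat ((3 * n) choose n)
         * rat_of_nat ((2 * n) choose n))
      = of_int 16 * ((\<Sum>n<p. wz_F n J) + (\<Sum>j=J..<p. wz_G p j))" .
  have "cong_zero p (of_int 16 * ((\<Sum>n<p. wz_F n J) + (\<Sum>j=J..<p. wz_G p j)))"
    using cong_zero_wz_F_middle[OF assms(1) J \<open>J > 0\<close>] cong_zero_wz_G_end[OF assms(1) J \<open>J > 0\<close>]
    by (intro cong_zero_mult_of_int cong_zero_add cong_zero_sum assms(1)) simp_all
  then show ?thesis
    unfolding eq by (rule cong_zero_imp_rat_cong[OF assms(1)])
qed

end
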